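(* There exists a string family on which $\delta = \Theta(\ell\sqrt{n})$. That is, there is an infinite set $\mathcal{F}$ of strings such that $\delta(w) = \Theta(\ell(w)\sqrt{n})$ for $w\in\mathcal{F}$, where $n=|w|$.
   Context: A string family is an infinite set of finite strings of unbounded length; asymptotic notation on a family refers to strings $w$ of the family with $n=|w|\to\infty$ (with constants uniform over the family). $w[i:j]$ denotes the substring of $w$ from position $i$ to position $j$ (positions start at 1). L-systems: an L-system is a tuple $(\Sigma,\varphi,\tau,s,d,n)$, where $\Sigma$ is a finite alphabet, $\varphi:\Sigma^*\to\Sigma^*$ is a non-erasing monoid endomorphism (each rule $a\to\varphi(a)$, $a\in\Sigma$, has $|\varphi(a)|\ge 1$), $\tau:\Sigma^*\to\Sigma^*$ is a coding (a morphism with $|\tau(a)|=1$ for all $a\in\Sigma$), $s\in\Sigma^+$ is the axiom, and $d\ge 0$, $n\ge 1$ are integers. It generates the unique string $\tau(\varphi^d(s))[1:n]$ of length $n$. It is always assumed that $d=n^{O(1)}$ and $|\Sigma|=n^{O(1)}$ (each value fits in an $O(\log n)$-bit word). The size of the L-system is $\sum_{a\in\Sigma}|\varphi(a)|+|s|+|\Sigma|+2$. The measure $\ell(w)$ is the size of the smallest L-system generating $w$. Substring complexity: let $P_w(k)$ be the number of distinct substrings of $w$ of length $k$. Then $\delta(w)=\max\{P_w(k)/k : 1\le k\le |w|\}$. *)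

theory Defs
  imports Complex_Main "HOL-Library.Sublist" "HOL-Library.Landau_Symbols"
begin

text \<open>
  Symbols are natural numbers, so that every string uses only finitely many of them and
  fresh auxiliary symbols are always available to an L-system. A monoid endomorphism
  is given by its images of letters, and a coding (which maps letters to words of length 1) by a
  letter-to-letter map.
\<close>

record lsys =
  alphabet :: "nat set"
  rules :: "nat \<Rightarrow> nat list"
  coding :: "nat \<Rightarrow> nat"
  start :: "nat list"
  depth :: nat
  len :: nat

definition morph :: "(nat \<Rightarrow> nat list) \<Rightarrow> nat list \<Rightarrow> nat list" where
  "morph f w = concat (map f w)"

text \<open>\<open>\<tau>(\<phi>\<^sup>d(s))\<close>, before taking the prefix of length \<open>n\<close>.\<close>

definition expansion :: "lsys \<Rightarrow> nat list" where
  "expansion L = map (coding L) ((morph (rules L) ^^ depth L) (start L))"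

text \<open>
  The last conjunct makes the prefix of length \<open>n\<close> exist. The functions \<open>rules\<close> and
  \<open>coding\<close> are irrelevant outside the alphabet.
\<close>

definition lsystem :: "lsys \<Rightarrow> bool" where
  "lsystem L \<longleftrightarrow>
     finite (alphabet L) \<and>
     (\<forall>a\<in>alphabet L. rules L a \<noteq> [] \<and> set (rules L a) \<subseteq> alphabet L) \<and>
     (\<forall>a\<in>alphabet L. coding L a \<in> alphabet L) \<and>
     start L \<noteq> [] \<and> set (start L) \<subseteq> alphabet L \<and>
     1 \<le> len L \<and> len L \<le> length (expansion L)"

definition generated :: "lsys \<Rightarrow> nat list" where
  "generated L = take (len L) (expansion L)"

text \<open>
  The standing assumption \<open>d = n\<^sup>O\<^sup>(\<^sup>1\<^sup>)\<close>, \<open>|\<Sigma>| = n\<^sup>O\<^sup>(\<^sup>1\<^sup>)\<close>, with the constant in the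
  exponent made an explicit parameter \<open>c\<close>.
\<close>

definition poly_bounded :: "nat \<Rightarrow> lsys \<Rightarrow> bool" where
  "poly_bounded c L \<longleftrightarrow> depth L \<le> len L ^ c \<and> card (alphabet L) \<le> len L ^ c"

definition lsize :: "lsys \<Rightarrow> nat" where
  "lsize L = (\<Sum>a\<in>alphabet L. length (rules L a)) + length (start L) + card (alphabet L) + 2"

definition ell :: "nat \<Rightarrow> nat list \<Rightarrow> nat" where
  "ell c w = (LEAST m. \<exists>L. lsystem L \<and> poly_bounded c L \<and> generated L = w \<and> lsize L = m)"

text \<open>For \<open>c \<ge> 1\<close> the minimum ranges over a nonempty set, for every nonempty string.\<close>

lemma ell_well_defined:
  assumes "w \<noteq> []" and "1 \<le> c"
  shows "\<exists>L. lsystem L \<and> poly_bounded c L \<and> generated L = w \<and> lsize L = ell c w"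
proof -
  let ?L = "\<lparr>alphabet = set w, rules = (\<lambda>a. [a]), coding = id, start = w, depth = 0,
             len = length w\<rparr>"
  have "card (set w) \<le> length w ^ 1" by (simp add: card_length)
  also have "\<dots> \<le> length w ^ c"
    using assms by (intro power_increasing) (simp_all add: Suc_leI)
  finally have "lsystem ?L \<and> poly_bounded c ?L \<and> generated ?L = w \<and> lsize ?L = lsize ?L"
    using assms by (simp add: lsystem_def poly_bounded_def generated_def expansion_def Suc_leI)
  then show ?thesis
    unfolding ell_def by (rule LeastI_ex[OF exI, OF exI])
qed

text \<open>\<^const>\<open>sublist\<close> is the contiguous-substring relation.\<close>

definition substr_count :: "'a list \<Rightarrow> nat \<Rightarrow> nat" where
  "substr_count w k = card {v. sublist v w \<and> length v = k}"

definition delta :: "'a list \<Rightarrow> real" where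
  "delta w = Max ((\<lambda>k. real (substr_count w k) / real k) ` {1..length w})"

definition string_family :: "'a list set \<Rightarrow> bool" where
  "string_family F \<longleftrightarrow> infinite F \<and> (\<forall>N. \<exists>w\<in>F. N \<le> length w)"

text \<open>The filter of strings \<open>w \<in> F\<close> with \<open>|w| \<rightarrow> \<infinity>\<close>.\<close>

definition along :: "'a list set \<Rightarrow> 'a list filter" where
  "along F = inf (filtercomap length at_top) (principal F)"

lemma eventually_along:
  "eventually P (along F) \<longleftrightarrow> (\<exists>N. \<forall>w\<in>F. N \<le> length w \<longrightarrow> P w)"
  unfolding along_def eventually_inf_principal eventually_filtercomap_at_top_linorder
  by auto

lemma along_neq_bot: "string_family F \<Longrightarrow> along F \<noteq> bot"
  by (auto simp: trivial_limit_def eventually_along string_family_def)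

end

theory Submission imports Defs begin

text \<open>
  The family consists of the words \<open>w\<^sub>d\<close> of length \<open>n = d\<^sup>2\<close> whose \<open>i\<close>-th letter, counted
  from 0, tells whether \<open>i\<close> is a perfect square. Since consecutive squares differ by consecutive odd
  numbers, the rules \<open>a \<rightarrow> ab\<close>, \<open>b \<rightarrow> ccb\<close>, \<open>c \<rightarrow> c\<close> started at \<open>a\<close> generate \<open>w\<^sub>d\<close> at depth \<open>d\<close> (with
  \<open>a\<close> and \<open>b\<close> coded as the same letter), so that \<open>\<ell>\<close> stays bounded.

  A window of length \<open>4M\<close> starting at a position at most \<open>M\<^sup>2\<close> contains two consecutive squares,
  whose distance and offset determine where it starts; hence there are more than \<open>M\<^sup>2\<close> different
  windows, which for \<open>M = d - 2\<close> gives \<open>\<delta> = \<Omega>(d)\<close>. Conversely, a window of length \<open>k < d\<close> starting at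
  a position at least \<open>k\<^sup>2\<close> contains at most one square, so there are at most \<open>k\<^sup>2 + k + 1\<close> windows of
  length \<open>k\<close>, and for \<open>k \<ge> d\<close> there are trivially at most \<open>d\<^sup>2\<close>.
\<close>

section \<open>Counting substrings by their starting positions\<close>

lemma sublists_of_length:
  "{v. sublist v w \<and> length v = k} = (\<lambda>i. take k (drop i w)) ` {i. i + k \<le> length w}"
proof (intro set_eqI iffI)
  fix v assume "v \<in> {v. sublist v w \<and> length v = k}"
  then obtain ps ss where "w = ps @ v @ ss" "length v = k"
    by (auto simp: sublist_def)
  then show "v \<in> (\<lambda>i. take k (drop i w)) ` {i. i + k \<le> length w}"
    by (intro image_eqI[of _ _ "length ps"]) auto
next
  fix v assume "v \<in> (\<lambda>i. take k (drop i w)) ` {i. i + k \<le> length w}"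
  then obtain i where "i + k \<le> length w" "v = take k (drop i w)" by auto
  then show "v \<in> {v. sublist v w \<and> length v = k}"
    using sublist_order.order.trans[OF sublist_take sublist_drop] by auto
qed

text \<open>Windows are read off the infinite sequence \<open>f\<close> itself, so that
  \<open>n\<close> only limits the admissible starts.\<close>

lemma substr_count_map_upt:
  "substr_count (map f [0..<n]) k = card ((\<lambda>i. map f [i..<i + k]) ` {i. i + k \<le> n})"
proof -
  have "(\<lambda>i. take k (drop i (map f [0..<n]))) ` {i. i + k \<le> n} =
        (\<lambda>i. map f [i..<i + k]) ` {i. i + k \<le> n}"
    by (intro image_cong) (auto simp: drop_map take_map)
  then show ?thesis
    by (simp add: substr_count_def sublists_of_length)
qed

lemma le_delta:
  assumes "1 \<le> k" "k \<le> length w"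
  shows "real (substr_count w k) / real k \<le> delta w"
  unfolding delta_def using assms by (intro Max_ge) auto

lemma delta_le:
  assumes "w \<noteq> []"
    and "\<And>k. 1 \<le> k \<Longrightarrow> k \<le> length w \<Longrightarrow> real (substr_count w k) \<le> C * real k"
  shows "delta w \<le> C"
proof -
  have "{1..length w} \<noteq> {}" using assms(1) by (simp add: Suc_leI)
  then show ?thesis
    unfolding delta_def using assms(2) by (subst Max_le_iff) (auto simp: divide_le_eq)
qed

section \<open>Prefixes of the indicator sequence of the squares\<close>

definition square_ind :: "nat \<Rightarrow> nat" where
  "square_ind i = (if \<exists>m. i = m\<^sup>2 then 1 else 0)"

definition square_word :: "nat \<Rightarrow> nat list" where
  "square_word d = map square_ind [0..<d\<^sup>2]"

lemma length_square_word [simp]: "length (square_word d) = d\<^sup>2"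
  by (simp add: square_word_def)

text \<open>Squaring is monotone, so the next candidate is \<open>(m + 1)\<^sup>2\<close>; expanded,
  the gap is linear in \<open>m\<close> once squares are treated as unknowns.\<close>

lemma no_square_between:
  fixes m r :: nat
  assumes "m\<^sup>2 < r\<^sup>2"
  shows "m\<^sup>2 + 2 * m + 1 \<le> r\<^sup>2"
proof -
  have "m < r" using assms by (rule power_less_imp_less_base) simp
  then have "(m + 1)\<^sup>2 \<le> r\<^sup>2" by (intro power_mono) auto
  then show ?thesis by (simp add: power2_eq_square)
qed

subsection \<open>An L-system of constant size\<close>

text \<open>The letters \<open>a\<close>, \<open>b\<close>, \<open>c\<close> are represented by
  \<open>2\<close>, \<open>1\<close>, \<open>0\<close>, so the coding only has to turn
  \<open>2\<close> into \<open>1\<close>.\<close>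

definition square_rules :: "nat \<Rightarrow> nat list" where
  "square_rules x = (if x = 2 then [2, 1] else if x = 1 then [0, 0, 1] else [x])"

definition square_lsys :: "nat \<Rightarrow> lsys" where
  "square_lsys d = \<lparr>alphabet = {0, 1, 2}, rules = square_rules,
     coding = (\<lambda>x. if x = 0 then 0 else 1), start = [2], depth = d, len = d\<^sup>2\<rparr>"

lemma morph_append: "morph f (u @ v) = morph f u @ morph f v"
  by (simp add: morph_def)

lemma morph_pow_append: "(morph f ^^ d) (u @ v) = (morph f ^^ d) u @ (morph f ^^ d) v"
  by (induction d) (simp_all add: morph_append)

lemma morph_square_rules_replicate_0:
  "morph square_rules (replicate n 0) = replicate n 0"
  by (induction n) (simp_all add: morph_def square_rules_def)

text \<open>Each application inserts two zeros before the final \<open>1\<close> and fixes the older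
  zeros.\<close>

lemma square_rules_pow_1:
  "(morph square_rules ^^ d) [1] = replicate (2 * d) 0 @ [1]"
proof (induction d)
  case (Suc d)
  have "morph square_rules [1] = replicate 2 0 @ [1]"
    by (simp add: morph_def square_rules_def numeral_2_eq_2)
  then show ?case
    using Suc by (simp add: morph_append morph_square_rules_replicate_0 flip: replicate_add)
qed simp

text \<open>This stretch starts just after the square \<open>d\<^sup>2\<close> and ends with the
  next one; it is exactly what a letter \<open>1\<close> grows into in \<open>d\<close>
  applications.\<close>

lemma square_ind_block:
  "map square_ind [d\<^sup>2 + 1..<(d + 1)\<^sup>2 + 1] = replicate (2 * d) 0 @ [1]"
proof -
  have "square_ind i = 0" if "i \<in> {d\<^sup>2 + 1..<(d + 1)\<^sup>2}" for i
  proof (rule ccontr)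
    assume "square_ind i \<noteq> 0"
    then obtain r where "i = r\<^sup>2" by (auto simp: square_ind_def split: if_splits)
    then have "d\<^sup>2 < r\<^sup>2" "r\<^sup>2 < d\<^sup>2 + 2 * d + 1" using that by (auto simp: power2_eq_square)
    then show False using no_square_between[of d r] by linarith
  qed
  then have "map square_ind [d\<^sup>2 + 1..<(d + 1)\<^sup>2] = replicate (2 * d) 0"
    by (intro replicate_eqI) (auto simp: power2_eq_square)
  moreover have "square_ind ((d + 1)\<^sup>2) = 1" by (auto simp: square_ind_def)
  moreover have "d\<^sup>2 + 1 \<le> (d + 1)\<^sup>2" by (simp add: power2_eq_square)
  ultimately show ?thesis by simp
qed

text \<open>The expansion ends with the \<open>1\<close> at position \<open>d\<^sup>2\<close>, which
  truncation to length \<open>d\<^sup>2\<close> removes.\<close>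

lemma expansion_square_lsys: "expansion (square_lsys d) = map square_ind [0..<d\<^sup>2 + 1]"
proof (induction d)
  case 0
  then show ?case by (simp add: expansion_def square_lsys_def square_ind_def)
next
  case (Suc d)
  \<comment> \<open>Splitting off the first application leaves the axiom, covered by the induction
    hypothesis, followed by one \<open>1\<close> that grows into the new block.\<close>
  have "(morph square_rules ^^ Suc d) [2] = (morph square_rules ^^ d) ([2] @ [1])"
    by (simp add: morph_def square_rules_def funpow_swap1)
  also have "\<dots> = (morph square_rules ^^ d) [2] @ replicate (2 * d) 0 @ [1]"
    by (simp only: morph_pow_append square_rules_pow_1)
  finally have "expansion (square_lsys (Suc d)) =
      expansion (square_lsys d) @ replicate (2 * d) 0 @ [1]"
    by (simp add: expansion_def square_lsys_def)
  also have "\<dots> = map square_ind ([0..<d\<^sup>2 + 1] @ [d\<^sup>2 + 1..<(d + 1)\<^sup>2 + 1])"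
    using Suc square_ind_block by (simp only: map_append)
  also have "[0..<d\<^sup>2 + 1] @ [d\<^sup>2 + 1..<(d + 1)\<^sup>2 + 1] = [0..<(d + 1)\<^sup>2 + 1]"
  proof -
    have "(d + 1)\<^sup>2 + 1 = d\<^sup>2 + 1 + (2 * d + 1)" by (simp add: power2_eq_square)
    then show ?thesis by (simp only: upt_add_eq_append[of 0, OF zero_le])
  qed
  finally show ?case by (simp only: Suc_eq_plus1)
qed

lemma generated_square_lsys: "generated (square_lsys d) = square_word d"
proof -
  have "len (square_lsys d) = d\<^sup>2" by (simp add: square_lsys_def)
  then show ?thesis
    by (simp add: generated_def expansion_square_lsys square_word_def)
qed

lemma lsystem_square_lsys:
  assumes "1 \<le> d"
  shows "lsystem (square_lsys d)"
proof -
  have "len (square_lsys d) \<le> length (expansion (square_lsys d))"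
    unfolding expansion_square_lsys by (simp add: square_lsys_def)
  moreover have "1 \<le> len (square_lsys d)"
    using assms by (simp add: square_lsys_def)
  ultimately show ?thesis
    by (simp add: lsystem_def) (simp add: square_lsys_def square_rules_def)
qed

lemma poly_bounded_square_lsys:
  assumes "2 \<le> d" "1 \<le> c"
  shows "poly_bounded c (square_lsys d)"
proof -
  have "d\<^sup>2 \<le> (d\<^sup>2) ^ c"
    using assms power_increasing[of 1 c "d\<^sup>2"] by simp
  moreover have "d \<le> d\<^sup>2" by (simp add: power2_eq_square)
  \<comment> \<open>The alphabet has three letters, which is too many for
    \<open>d = 1\<close>.\<close>
  moreover have "3 \<le> d\<^sup>2"
    using power_mono[OF assms(1), of 2] by simp
  ultimately show ?thesis
    by (simp add: poly_bounded_def square_lsys_def)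
qed

lemma ell_square_word_le:
  assumes "2 \<le> d" "1 \<le> c"
  shows "ell c (square_word d) \<le> 12"
proof -
  \<comment> \<open>The rules contribute 1 + 3 + 2, the axiom 1, the alphabet 3, and the definition
    adds 2.\<close>
  have "lsize (square_lsys d) = 12"
    by (simp add: lsize_def square_lsys_def square_rules_def)
  then show ?thesis
    unfolding ell_def using assms
    by (intro Least_le exI[of _ "square_lsys d"])
      (simp add: lsystem_square_lsys poly_bounded_square_lsys generated_square_lsys)
qed

lemma ell_pos:
  assumes "w \<noteq> []" "1 \<le> c"
  shows "1 \<le> ell c w"
proof -
  obtain L where "lsize L = ell c w"
    using ell_well_defined[OF assms] by blast
  then show ?thesis by (simp add: lsize_def)
qed

subsection \<open>Windows of the indicator sequence of the squares\<close>

text \<open>Equal windows at \<open>i < j\<close> would shift two consecutive squares by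
  \<open>j - i\<close> onto larger squares at the same distance, but gaps between squares
  increase.\<close>

lemma inj_on_square_windows:
  "inj_on (\<lambda>i. map square_ind [i..<i + 4 * M]) {..M\<^sup>2}"
proof (rule linorder_inj_onI')
  fix i j :: nat
  assume "i < j" "i \<in> {..M\<^sup>2}" "j \<in> {..M\<^sup>2}"
  then have "i < M\<^sup>2" by simp
  define m where "m = (LEAST m. i \<le> m\<^sup>2)"
  have "i \<le> m\<^sup>2"
    unfolding m_def using \<open>i < M\<^sup>2\<close> by (intro LeastI[of "\<lambda>m. i \<le> m\<^sup>2" M]) simp
  have "m \<le> M"
    unfolding m_def using \<open>i < M\<^sup>2\<close> by (intro Least_le) simp
  \<comment> \<open>The first square from \<open>i\<close> on is \<open>m\<^sup>2\<close>. For
    positive \<open>m\<close> the previous square lies before \<open>i\<close>, and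
    \<open>(m + 1)\<^sup>2 - (m - 1)\<^sup>2 = 4 * m\<close>; hence the window length
    \<open>4 * M\<close>.\<close>
  have "i + 4 * M > (m + 1)\<^sup>2"
  proof (cases m)
    case 0
    have "M > 0" using \<open>i < M\<^sup>2\<close> by (cases M) auto
    then show ?thesis using 0 by simp
  next
    case (Suc p)
    then have "\<not> i \<le> p\<^sup>2"
      using not_less_Least[of p "\<lambda>m. i \<le> m\<^sup>2"] unfolding m_def[symmetric] by simp
    moreover have "(m + 1)\<^sup>2 = p\<^sup>2 + 4 * m"
      by (simp add: Suc power2_eq_square)
    ultimately show ?thesis
      using \<open>m \<le> M\<close> by linarith
  qed
  show "map square_ind [i..<i + 4 * M] \<noteq> map square_ind [j..<j + 4 * M]"
  proof
    assume eq: "map square_ind [i..<i + 4 * M] = map square_ind [j..<j + 4 * M]"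
    have shift: "\<exists>q. s + (j - i) = q\<^sup>2" if "i \<le> s" "s < i + 4 * M" "\<exists>q. s = q\<^sup>2" for s
    proof -
      have "square_ind s = square_ind (s + (j - i))"
        using arg_cong[OF eq, of "\<lambda>xs. xs ! (s - i)"] that \<open>i < j\<close>
        by (simp add: add.commute)
      then show ?thesis using that(3) by (simp add: square_ind_def split: if_splits)
    qed
    have lt: "m\<^sup>2 < (m + 1)\<^sup>2" by (simp add: power2_eq_square)
    obtain p where p: "m\<^sup>2 + (j - i) = p\<^sup>2"
      using shift[of "m\<^sup>2"] \<open>i \<le> m\<^sup>2\<close> \<open>i + 4 * M > (m + 1)\<^sup>2\<close> lt by auto
    obtain q where q: "(m + 1)\<^sup>2 + (j - i) = q\<^sup>2"
      using shift[of "(m + 1)\<^sup>2"] \<open>i \<le> m\<^sup>2\<close> \<open>i + 4 * M > (m + 1)\<^sup>2\<close> lt by auto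
    have "m\<^sup>2 < p\<^sup>2" using p \<open>i < j\<close> by simp
    then have "m < p" by (rule power_less_imp_less_base) simp
    have "p\<^sup>2 < q\<^sup>2" using p q lt by simp
    then have "p\<^sup>2 + 2 * p + 1 \<le> q\<^sup>2" by (rule no_square_between)
    moreover have "(m + 1)\<^sup>2 = m\<^sup>2 + 2 * m + 1" by (simp add: power2_eq_square)
    ultimately show False
      using p q \<open>m < p\<close> by linarith
  qed
qed

text \<open>All squares in the window have roots at least \<open>k\<close>, so two of them would be
  more than \<open>2 * k\<close> apart.\<close>

lemma square_window_far:
  assumes "k\<^sup>2 \<le> i"
  shows "map square_ind [i..<i + k] \<in>
    insert (replicate k 0) ((\<lambda>j. (replicate k 0)[j := 1]) ` {..<k})"
proof (cases "\<exists>j<k. \<exists>m. i + j = m\<^sup>2")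
  case True
  then obtain j m where "j < k" and m: "i + j = m\<^sup>2" by blast
  have "square_ind (i + t) = 0" if t: "t < k" "t \<noteq> j" for t
  proof (rule ccontr)
    assume "square_ind (i + t) \<noteq> 0"
    then obtain r where r: "i + t = r\<^sup>2"
      by (auto simp: square_ind_def split: if_splits)
    have ge: "k \<le> m" "k \<le> r"
      by (rule power2_le_imp_le; use assms m r in linarith)+
    consider "m\<^sup>2 < r\<^sup>2" | "r\<^sup>2 < m\<^sup>2"
      using m r t(2) by linarith
    then show False
    proof cases
      case 1
      then have "m\<^sup>2 + 2 * m + 1 \<le> r\<^sup>2"
        by (rule no_square_between)
      then show False using m r ge(1) t(1) by linarith
    next
      case 2
      then have "r\<^sup>2 + 2 * r + 1 \<le> m\<^sup>2"
        by (rule no_square_between)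
      then show False using m r ge(2) \<open>j < k\<close> by linarith
    qed
  qed
  moreover have "square_ind (i + j) = 1" using m by (auto simp: square_ind_def)
  ultimately have "square_ind (i + t) = (replicate k 0)[j := 1] ! t" if "t < k" for t
    using that by (cases "t = j") simp_all
  then have "map square_ind [i..<i + k] = (replicate k 0)[j := 1]"
    by (intro nth_equalityI) simp_all
  then show ?thesis using \<open>j < k\<close> by blast
next
  case False
  then have "map square_ind [i..<i + k] = replicate k 0"
    by (intro nth_equalityI) (auto simp: square_ind_def)
  then show ?thesis by blast
qed

lemma substr_count_square_word_le:
  "substr_count (square_word d) k \<le> k\<^sup>2 + (k + 1)"
proof -
  define window where "window i = map square_ind [i..<i + k]" for i
  define far :: "nat list set" where "far = (\<lambda>j. (replicate k 0)[j := 1]) ` {..<k}"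
  have "window i \<in> window ` {..<k\<^sup>2} \<union> insert (replicate k 0) far" for i
  proof (cases "i < k\<^sup>2")
    case False
    then show ?thesis
      using square_window_far[of k i] unfolding window_def far_def by (intro UnI2) simp
  qed blast
  then have "window ` {i. i + k \<le> d\<^sup>2} \<subseteq> window ` {..<k\<^sup>2} \<union> insert (replicate k 0) far"
    by blast
  moreover have "finite far" by (simp add: far_def)
  ultimately have "substr_count (square_word d) k \<le>
      card (window ` {..<k\<^sup>2} \<union> insert (replicate k 0) far)"
    unfolding square_word_def substr_count_map_upt window_def by (intro card_mono) auto
  also have "\<dots> \<le> card (window ` {..<k\<^sup>2}) + card (insert (replicate k 0) far)"
    by (rule card_Un_le)
  also have "\<dots> \<le> k\<^sup>2 + (k + 1)"
  proof (rule add_mono)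
    show "card (window ` {..<k\<^sup>2}) \<le> k\<^sup>2"
      using card_image_le[of "{..<k\<^sup>2}" window] by simp
    have "card far \<le> k"
      unfolding far_def
      using card_image_le[of "{..<k}" "\<lambda>j. (replicate k 0)[j := 1] :: nat list"] by simp
    then show "card (insert (replicate k 0) far) \<le> k + 1"
      using \<open>finite far\<close> by (simp add: card_insert_if)
  qed
  finally show ?thesis .
qed

lemma substr_count_square_word_le_length:
  assumes "1 \<le> k"
  shows "substr_count (square_word d) k \<le> d\<^sup>2"
proof -
  have sub: "{i. i + k \<le> d\<^sup>2} \<subseteq> {..<d\<^sup>2}" using assms by auto
  have "substr_count (square_word d) k \<le> card {i. i + k \<le> d\<^sup>2}"
    unfolding square_word_def substr_count_map_upt
    using finite_subset[OF sub] by (intro card_image_le) simp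
  also have "\<dots> \<le> d\<^sup>2"
    using card_mono[OF _ sub] by simp
  finally show ?thesis .
qed

section \<open>Linear bounds on \<open>delta\<close> in terms of \<open>d\<close>\<close>

lemma delta_square_word_le:
  assumes "1 \<le> d"
  shows "delta (square_word d) \<le> 3 * real d"
proof (rule delta_le)
  show "square_word d \<noteq> []"
    using assms by (simp flip: length_greater_0_conv)
  fix k :: nat assume "1 \<le> k"
  have "substr_count (square_word d) k \<le> 3 * d * k"
  proof (cases "k \<le> d")
    case True
    \<comment> \<open>Each of the three terms of \<open>k\<^sup>2 + k + 1\<close> is at most
      \<open>d * k\<close>, whence the factor 3.\<close>
    then have "k * k \<le> d * k" "k \<le> d * k" "1 \<le> d * k"
      using assms \<open>1 \<le> k\<close> by simp_all
    then show ?thesis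
      using substr_count_square_word_le[of d k] unfolding power2_eq_square by linarith
  next
    case False
    then have "d * d \<le> d * k" by simp
    then show ?thesis
      using substr_count_square_word_le_length[OF \<open>1 \<le> k\<close>, of d]
      unfolding power2_eq_square by linarith
  qed
  then have "real (substr_count (square_word d) k) \<le> real (3 * d * k)"
    by (simp only: of_nat_le_iff)
  then show "real (substr_count (square_word d) k) \<le> 3 * real d * real k" by simp
qed

lemma delta_square_word_ge:
  assumes "4 \<le> d"
  shows "real d / 8 \<le> delta (square_word d)"
proof -
  \<comment> \<open>Now \<open>M\<^sup>2 + 4 * M = d\<^sup>2 - 4\<close>, so every window starting
    at or before \<open>M\<^sup>2\<close> fits into the word.\<close>
  define M where "M = d - 2"
  have d: "d = M + 2" and "2 \<le> M" using assms by (simp_all add: M_def)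
  have fits: "M\<^sup>2 + 4 * M \<le> d\<^sup>2" by (simp add: d power2_eq_square)
  have "{..M\<^sup>2} \<subseteq> {i. i + 4 * M \<le> d\<^sup>2}" using fits by auto
  moreover have "finite {i. i + 4 * M \<le> d\<^sup>2}"
    by (rule finite_subset[of _ "{..d\<^sup>2}"]) auto
  ultimately have "card ((\<lambda>i. map square_ind [i..<i + 4 * M]) ` {..M\<^sup>2}) \<le>
      substr_count (square_word d) (4 * M)"
    unfolding square_word_def substr_count_map_upt by (intro card_mono image_mono) auto
  then have "M\<^sup>2 \<le> substr_count (square_word d) (4 * M)"
    by (simp add: card_image[OF inj_on_square_windows])
  then have "real (M\<^sup>2) / real (4 * M) \<le> real (substr_count (square_word d) (4 * M)) / real (4 * M)"
    by (intro divide_right_mono) simp_all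
  also have "\<dots> \<le> delta (square_word d)"
    using fits \<open>2 \<le> M\<close> by (intro le_delta) auto
  \<comment> \<open>The bound obtained is \<open>M / 4\<close>, and it is at least
    \<open>(M + 2) / 8\<close> because \<open>2 \<le> M\<close>.\<close>
  finally show ?thesis
    using \<open>2 \<le> M\<close> by (simp add: d power2_eq_square)
qed

lemma string_family_square_word: "string_family (range square_word)"
proof -
  have "inj square_word"
    by (rule injI) (metis length_square_word power2_eq_iff_nonneg zero_le)
  then have "infinite (range square_word)" by (simp add: finite_image_iff)
  moreover have "N \<le> length (square_word N)" for N
    by (simp add: power2_eq_square)
  ultimately show ?thesis unfolding string_family_def by blast
qed

theorem lemma1:
  "\<exists>F :: nat list set. string_family F \<and>
     (\<forall>c\<ge>1. delta \<in> \<Theta>[along F](\<lambda>w. real (ell c w) * sqrt (real (length w))))"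
proof (intro exI[of _ "range square_word"] conjI allI impI string_family_square_word)
  fix c :: nat assume "1 \<le> c"
  let ?g = "\<lambda>w. real (ell c w) * sqrt (real (length w))"
  \<comment> \<open>Here \<open>?g w\<close> lies between \<open>d\<close> and
    \<open>12 * d\<close>, and \<open>1 / 96\<close> is \<open>1 / 8\<close> divided by 12. Length
    at least 16 means \<open>4 \<le> d\<close>. None of these constants depends on
    \<open>c\<close>.\<close>
  have bounds: "1 / 96 * ?g w \<le> delta w \<and> delta w \<le> 3 * ?g w"
    if w: "w \<in> range square_word" "16 \<le> length w" for w
  proof -
    obtain d where d: "w = square_word d" using w(1) by auto
    have "4\<^sup>2 \<le> d\<^sup>2" using w(2) d by simp
    then have "4 \<le> d" by (rule power2_le_imp_le) simp
    have g: "?g w = real (ell c w) * real d" by (simp add: d real_sqrt_abs)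
    have "w \<noteq> []" using w(2) by auto
    then have ge: "1 \<le> ell c w" using ell_pos \<open>1 \<le> c\<close> by blast
    have le: "ell c w \<le> 12"
      using ell_square_word_le[of d c] \<open>4 \<le> d\<close> \<open>1 \<le> c\<close> d by simp
    have "1 * real d \<le> ?g w" "?g w \<le> 12 * real d"
      unfolding g using ge le by (intro mult_right_mono; simp)+
    moreover have "real d / 8 \<le> delta w" "delta w \<le> 3 * real d"
      using delta_square_word_ge delta_square_word_le \<open>4 \<le> d\<close> d by auto
    ultimately show ?thesis by linarith
  qed
  have nonneg: "0 \<le> ?g w" for w by simp
  have "\<forall>\<^sub>F w in along (range square_word). norm (delta w) \<le> 3 * norm (?g w)"
    unfolding eventually_along
  proof (intro exI[of _ 16] ballI impI)
    fix w assume "w \<in> range square_word" "16 \<le> length w"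
    then show "norm (delta w) \<le> 3 * norm (?g w)"
      using bounds[of w] nonneg[of w] unfolding real_norm_def by linarith
  qed
  moreover have "\<forall>\<^sub>F w in along (range square_word). norm (delta w) \<ge> 1 / 96 * norm (?g w)"
    unfolding eventually_along
  proof (intro exI[of _ 16] ballI impI)
    fix w assume "w \<in> range square_word" "16 \<le> length w"
    then show "norm (delta w) \<ge> 1 / 96 * norm (?g w)"
      using bounds[of w] nonneg[of w] unfolding real_norm_def by linarith
  qed
  ultimately show "delta \<in> \<Theta>[along (range square_word)](?g)"
    by (intro bigthetaI landau_o.bigI[of 3] landau_omega.bigI[of "1 / 96"]) simp_all
qed

end
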